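(* Let $\mathscr{A}$ be a complex Banach algebra with unity $1$, let $\lambda\in\mathbb{C}$ with $\lambda\neq 0$, and let $a,b\in\mathscr{A}$ be p-Drazin invertible with $ab=\lambda ba$. Then: (1) $a^{\ddagger}b=\lambda^{-1}ba^{\ddagger}$; (2) $ab^{\ddagger}=\lambda^{-1}b^{\ddagger}a$; (3) $ab$ is p-Drazin invertible and $(ab)^{\ddagger}=b^{\ddagger}a^{\ddagger}=\lambda^{-1}a^{\ddagger}b^{\ddagger}$.
   Context: $J(\mathscr{A})$ denotes the Jacobson radical of $\mathscr{A}$. An element $a\in\mathscr{A}$ is called pseudo Drazin invertible (p-Drazin invertible) if there exists $x\in\mathscr{A}$ such that $ax=xa$, $xax=x$, and $a^{k}-a^{k+1}x\in J(\mathscr{A})$ for some integer $k\geqslant 1$. Such an $x$ is unique when it exists; it is called the p-Drazin inverse of $a$ and is denoted by $a^{\ddagger}$. *)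

theory Defs
  imports "HOL-Analysis.Analysis"
begin

text \<open>
  Complex Banach algebras with unity. Complex scalar multiplication extends the real one of the
  library classes. The normalisation \<open>norm 1 = 1\<close> is not imposed, which is why the class extends
  \<open>real_normed_algebra\<close> and \<open>real_algebra_1\<close> rather than \<open>real_normed_algebra_1\<close>.
\<close>

class complex_banach_algebra_1 = real_normed_algebra + real_algebra_1 + banach +
  fixes scaleC :: "complex \<Rightarrow> 'a \<Rightarrow> 'a" (infixr \<open>*\<^sub>C\<close> 75)
  assumes scaleC_add_right: "c *\<^sub>C (x + y) = c *\<^sub>C x + c *\<^sub>C y"
    and scaleC_add_left: "(c + d) *\<^sub>C x = c *\<^sub>C x + d *\<^sub>C x"
    and scaleC_scaleC: "c *\<^sub>C d *\<^sub>C x = (c * d) *\<^sub>C x"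
    and scaleC_of_real: "complex_of_real r *\<^sub>C x = r *\<^sub>R x"
    and norm_scaleC: "norm (c *\<^sub>C x) = cmod c * norm x"
    and mult_scaleC_left: "(c *\<^sub>C x) * y = c *\<^sub>C (x * y)"
    and mult_scaleC_right: "x * (c *\<^sub>C y) = c *\<^sub>C (x * y)"

definition left_ideal :: "'a::ring_1 set \<Rightarrow> bool" where
  "left_ideal I \<longleftrightarrow>
     0 \<in> I \<and> (\<forall>x\<in>I. \<forall>y\<in>I. x + y \<in> I) \<and> (\<forall>r. \<forall>x\<in>I. r * x \<in> I)"

definition maximal_left_ideal :: "'a::ring_1 set \<Rightarrow> bool" where
  "maximal_left_ideal M \<longleftrightarrow>
     left_ideal M \<and> M \<noteq> UNIV \<and> (\<forall>I. left_ideal I \<longrightarrow> M \<subseteq> I \<longrightarrow> I = M \<or> I = UNIV)"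

definition jacobson_radical :: "'a::ring_1 set" where
  "jacobson_radical = \<Inter> {M. maximal_left_ideal M}"

definition is_p_drazin_inverse :: "'a::ring_1 \<Rightarrow> 'a \<Rightarrow> bool" where
  "is_p_drazin_inverse a x \<longleftrightarrow>
     a * x = x * a \<and> x * a * x = x \<and> (\<exists>k\<ge>1. a ^ k - a ^ (k + 1) * x \<in> jacobson_radical)"

definition p_drazin_invertible :: "'a::ring_1 \<Rightarrow> bool" where
  "p_drazin_invertible a \<longleftrightarrow> (\<exists>x. is_p_drazin_inverse a x)"

definition p_drazin_inverse :: "'a::ring_1 \<Rightarrow> 'a" (\<open>(_\<^sup>\<ddagger>)\<close> [1000] 999) where
  "a\<^sup>\<ddagger> = (THE x. is_p_drazin_inverse a x)"

end

theory Submission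
  imports Defs
begin

text \<open>
  Let \<open>x\<close> be a p-Drazin inverse of \<open>a\<close> and \<open>p = ax\<close>. Some power of \<open>a(1 - p)\<close> lies in the Jacobson
  radical, so \<open>a(1 - p)\<close> is quasinilpotent. Since
  \<open>pb(1 - p) = x\<^sup>na\<^sup>nb(1 - p) = \<mu>\<^sup>nx\<^sup>nb(a(1 - p))\<^sup>n\<close> for every \<open>n\<close>, this element vanishes, and so does
  \<open>(1 - p)bp\<close>; hence \<open>p\<close> commutes with \<open>b\<close>, and the commutation relation passes from \<open>a\<close> to \<open>x\<close>.
  That a trivial spectrum forces quasinilpotence is shown without vector-valued complex analysis:
  the average of the resolvent \<open>c \<mapsto> (1 - cz)\<^sup>-\<^sup>1\<close> over the \<open>n\<close>-th roots of unity times \<open>r\<close> is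
  \<open>(1 - r\<^sup>nz\<^sup>n)\<^sup>-\<^sup>1\<close>, and these averages are equicontinuous in \<open>r\<close>, uniformly in \<open>n\<close>.
\<close>

section \<open>The Jacobson radical\<close>

lemma left_idealD:
  assumes "left_ideal (I::'a::ring_1 set)"
  shows "0 \<in> I" "x \<in> I \<Longrightarrow> y \<in> I \<Longrightarrow> x + y \<in> I" "x \<in> I \<Longrightarrow> r * x \<in> I"
  using assms unfolding left_ideal_def by simp_all

lemma left_ideal_principal: "left_ideal (range (\<lambda>r. r * (u::'a::ring_1)))"
  unfolding left_ideal_def
proof (intro conjI ballI allI)
  show "0 \<in> range (\<lambda>r. r * u)" by (rule image_eqI[where x=0]) auto
next
  fix x y assume "x \<in> range (\<lambda>r. r * u)" "y \<in> range (\<lambda>r. r * u)"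
  then obtain s t where "x = s * u" "y = t * u" by blast
  then show "x + y \<in> range (\<lambda>r. r * u)"
    by (intro image_eqI[where x="s + t"]) (auto simp: algebra_simps)
next
  fix r x assume "x \<in> range (\<lambda>r. r * u)"
  then obtain s where "x = s * u" by blast
  then show "r * x \<in> range (\<lambda>r. r * u)"
    by (intro image_eqI[where x="r * s"]) (auto simp: algebra_simps)
qed

lemma left_ideal_sum:
  assumes "left_ideal I" "left_ideal K"
  shows "left_ideal {x + y | x y. x \<in> I \<and> y \<in> (K::'a::ring_1 set)}"
  unfolding left_ideal_def
proof (intro conjI ballI allI)
  show "0 \<in> {x + y | x y. x \<in> I \<and> y \<in> K}"
    using assms unfolding left_ideal_def by force
next
  fix u v assume "u \<in> {x + y | x y. x \<in> I \<and> y \<in> K}" "v \<in> {x + y | x y. x \<in> I \<and> y \<in> K}"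
  then obtain x y x' y' where *: "u = x + y" "v = x' + y'" "x \<in> I" "x' \<in> I" "y \<in> K" "y' \<in> K"
    by blast
  then have "u + v = (x + x') + (y + y')" by (simp add: algebra_simps)
  moreover have "x + x' \<in> I" "y + y' \<in> K" using * assms unfolding left_ideal_def by blast+
  ultimately show "u + v \<in> {x + y | x y. x \<in> I \<and> y \<in> K}" by blast
next
  fix r u assume "u \<in> {x + y | x y. x \<in> I \<and> y \<in> K}"
  then obtain x y where *: "u = x + y" "x \<in> I" "y \<in> K" by blast
  then have "r * u = r * x + r * y" by (simp add: algebra_simps)
  moreover have "r * x \<in> I" "r * y \<in> K" using * assms unfolding left_ideal_def by blast+
  ultimately show "r * u \<in> {x + y | x y. x \<in> I \<and> y \<in> K}" by blast
qed

lemma left_ideal_eq_UNIV_iff: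
  assumes "left_ideal (I::'a::ring_1 set)"
  shows "I = UNIV \<longleftrightarrow> 1 \<in> I"
proof
  assume "1 \<in> I"
  then have "r * 1 \<in> I" for r using assms unfolding left_ideal_def by blast
  then show "I = UNIV" by auto
qed simp

lemma left_ideal_Union_chain:
  assumes "C \<noteq> {}" "\<And>I. I \<in> C \<Longrightarrow> left_ideal (I::'a::ring_1 set)" "chain\<^sub>\<subseteq> C"
  shows "left_ideal (\<Union>C)"
  unfolding left_ideal_def
proof (intro conjI ballI allI)
  show "0 \<in> \<Union>C" using assms(1,2) unfolding left_ideal_def by blast
next
  fix x y assume "x \<in> \<Union>C" "y \<in> \<Union>C"
  then obtain I K where *: "x \<in> I" "I \<in> C" "y \<in> K" "K \<in> C" by blast
  then have "I \<subseteq> K \<or> K \<subseteq> I" using assms(3) unfolding chain_subset_def by blast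
  then have "\<exists>L\<in>C. x \<in> L \<and> y \<in> L" using * by blast
  then show "x + y \<in> \<Union>C" using assms(2) unfolding left_ideal_def by blast
next
  fix r x assume "x \<in> \<Union>C"
  then show "r * x \<in> \<Union>C" using assms(2) unfolding left_ideal_def by blast
qed

text \<open>Zorn's lemma, with properness expressed as \<open>1 \<notin> K\<close> because that form
  survives unions of chains.\<close>

lemma maximal_left_ideal_exists:
  assumes "left_ideal (I::'a::ring_1 set)" "1 \<notin> I"
  shows "\<exists>M. maximal_left_ideal M \<and> I \<subseteq> M"
proof -
  let ?A = "{K. left_ideal K \<and> I \<subseteq> K \<and> 1 \<notin> K}"
  have "\<exists>M\<in>?A. \<forall>X\<in>?A. M \<subseteq> X \<longrightarrow> X = M"
  proof (rule subset_Zorn_nonempty)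
    show "?A \<noteq> {}" using assms by blast
    fix C assume C: "C \<noteq> {}" "subset.chain ?A C"
    then have "chain\<^sub>\<subseteq> C" "C \<subseteq> ?A"
      unfolding subset.chain_def chain_subset_def by blast+
    then show "\<Union>C \<in> ?A"
      using left_ideal_Union_chain[of C] C(1) by blast
  qed
  then obtain M where M: "M \<in> ?A" "\<forall>X\<in>?A. M \<subseteq> X \<longrightarrow> X = M" by (rule bexE)
  have "maximal_left_ideal M"
    unfolding maximal_left_ideal_def
  proof (intro conjI allI impI)
    show "left_ideal M" "M \<noteq> UNIV" using M(1) by auto
    fix K assume K: "left_ideal K" "M \<subseteq> K"
    show "K = M \<or> K = UNIV"
    proof (cases "1 \<in> K")
      case True
      then show ?thesis using left_ideal_eq_UNIV_iff[OF K(1)] by simp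
    next
      case False
      then have "K \<in> ?A" using K M(1) by auto
      then show ?thesis using M(2) K(2) by simp
    qed
  qed
  then show ?thesis using M(1) by auto
qed

text \<open>If \<open>1 - r * z\<close> has no left inverse, the left ideal it generates lies in a
  maximal one, which contains \<open>z\<close> and hence \<open>1\<close>. Conversely, if a maximal
  \<open>M\<close> misses \<open>z\<close>, then \<open>M\<close> together with the multiples of
  \<open>z\<close> spans everything, so some \<open>1 - r * z\<close> lies in \<open>M\<close>;
  being left invertible, it puts \<open>1\<close> into \<open>M\<close>.\<close>

lemma jacobson_radical_iff_left_inverse:
  "z \<in> jacobson_radical \<longleftrightarrow> (\<forall>r. \<exists>h. h * (1 - r * z) = (1::'a::ring_1))"
proof (intro iffI allI)
  fix r assume z: "z \<in> jacobson_radical"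
  show "\<exists>h. h * (1 - r * z) = 1"
  proof (rule ccontr)
    assume "\<nexists>h. h * (1 - r * z) = 1"
    then have "1 \<notin> range (\<lambda>h. h * (1 - r * z))" by (metis imageE)
    from maximal_left_ideal_exists[OF left_ideal_principal this] obtain M
      where M: "maximal_left_ideal M" "range (\<lambda>h. h * (1 - r * z)) \<subseteq> M" by blast
    have I: "left_ideal M" "M \<noteq> UNIV" using M(1) unfolding maximal_left_ideal_def by auto
    have "1 * (1 - r * z) \<in> M" using M(2) by blast
    moreover have "z \<in> M" using z M(1) unfolding jacobson_radical_def by simp
    then have "r * z \<in> M" by (rule left_idealD(3)[OF I(1)])
    ultimately have "1 * (1 - r * z) + r * z \<in> M" by (rule left_idealD(2)[OF I(1)])
    then show False using I(2) left_ideal_eq_UNIV_iff[OF I(1)] by simp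
  qed
next
  assume inv: "\<forall>r. \<exists>h. h * (1 - r * z) = 1"
  have "z \<in> M" if M: "maximal_left_ideal M" for M
  proof (rule ccontr)
    assume "z \<notin> M"
    have I: "left_ideal M" "M \<noteq> UNIV" using M unfolding maximal_left_ideal_def by auto
    let ?S = "{x + y | x y. x \<in> M \<and> y \<in> range (\<lambda>r. r * z)}"
    have S: "left_ideal ?S" by (rule left_ideal_sum[OF I(1) left_ideal_principal])
    have "M \<subseteq> ?S"
    proof
      fix m assume "m \<in> M"
      then have "m = m + 0 * z \<and> m \<in> M" by simp
      then show "m \<in> ?S" by blast
    qed
    have "0 \<in> M" by (rule left_idealD(1)[OF I(1)])
    have "z = 0 + 1 * z" by simp
    with \<open>0 \<in> M\<close> have "z \<in> ?S" by blast
    with \<open>z \<notin> M\<close> have "?S \<noteq> M" by metis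
    moreover have "?S = M \<or> ?S = UNIV"
      using M S \<open>M \<subseteq> ?S\<close> unfolding maximal_left_ideal_def by simp
    ultimately have "?S = UNIV" by simp
    then have "1 \<in> ?S" by simp
    then obtain m r where mr: "1 = m + r * z" "m \<in> M" by blast
    obtain h where "h * (1 - r * z) = 1" using inv by blast
    moreover have "1 - r * z = m" using mr(1) by (metis add_diff_cancel_right')
    ultimately have "1 \<in> M" using left_idealD(3)[OF I(1) mr(2)] by metis
    then show False using I(2) left_ideal_eq_UNIV_iff[OF I(1)] by simp
  qed
  then show "z \<in> jacobson_radical" unfolding jacobson_radical_def by blast
qed

lemma left_ideal_jacobson_radical: "left_ideal (jacobson_radical :: 'a::ring_1 set)"
  unfolding left_ideal_def jacobson_radical_def maximal_left_ideal_def by simp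

lemmas jacobson_radical_add = left_idealD(2)[OF left_ideal_jacobson_radical]
  and jacobson_radical_mult_left = left_idealD(3)[OF left_ideal_jacobson_radical]

text \<open>A left inverse \<open>h\<close> of \<open>1 - v * u\<close> yields the left inverse
  \<open>1 + u * h * v\<close> of \<open>1 - u * v\<close>; here \<open>u = r * z\<close> and
  \<open>v = t\<close>.\<close>

lemma jacobson_radical_mult_right:
  assumes "z \<in> jacobson_radical"
  shows "z * t \<in> jacobson_radical"
  unfolding jacobson_radical_iff_left_inverse
proof
  fix r
  obtain h where h: "h * (1 - (t * r) * z) = 1"
    using assms unfolding jacobson_radical_iff_left_inverse by blast
  have "(1 + r * z * h * t) * (1 - r * (z * t))
      = 1 - r * z * t + r * z * (h * (1 - (t * r) * z)) * t"
    by (simp add: algebra_simps)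
  also have "\<dots> = 1" by (simp add: h)
  finally show "\<exists>h. h * (1 - r * (z * t)) = 1" by blast
qed

text \<open>A left inverse \<open>h\<close> of \<open>1 - z\<close> is itself of the form
  \<open>1 - r * z\<close> with \<open>r = - h\<close>, so it has a left inverse too. With
  \<open>1 - z\<close> as a right inverse, \<open>h\<close> is then invertible.\<close>

lemma jacobson_radical_inverse:
  assumes "z \<in> jacobson_radical"
  shows "\<exists>h. h * (1 - z) = 1 \<and> (1 - z) * h = 1"
proof -
  obtain h where h: "h * (1 - z) = 1"
    using assms unfolding jacobson_radical_iff_left_inverse by (metis mult_1)
  have "h - h * z = 1" using h by (simp add: right_diff_distrib)
  then have "h = 1 - (- h) * z" by (simp add: diff_eq_eq)
  then obtain g where g: "g * h = 1"
    using assms unfolding jacobson_radical_iff_left_inverse by metis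
  have "g = g * (h * (1 - z))" by (simp add: h)
  also have "\<dots> = 1 - z" by (simp only: mult.assoc[symmetric] g mult_1)
  finally show ?thesis using h g by blast
qed

text \<open>\<open>e\<close> annihilates the invertible element \<open>1 - e\<close>.\<close>

lemma jacobson_radical_idempotent:
  assumes "e \<in> jacobson_radical" "e * e = e"
  shows "e = 0"
proof -
  obtain h where "(1 - e) * h = 1" using jacobson_radical_inverse[OF assms(1)] by blast
  then have "e * ((1 - e) * h) = e" by simp
  moreover have "e * ((1 - e) * h) = (e - e * e) * h" by (simp add: algebra_simps)
  ultimately show ?thesis using assms(2) by simp
qed

section \<open>Geometric sums and elements with a power in the radical\<close>

lemma geometric_factor_left: "(1 - u) * (\<Sum>j<n. u ^ j) = 1 - (u::'a::ring_1) ^ n"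
proof (induction n)
  case (Suc n)
  have "(1 - u) * (\<Sum>j<Suc n. u ^ j) = 1 - u ^ n + (1 - u) * u ^ n"
    by (simp only: sum.lessThan_Suc distrib_left Suc)
  then show ?case by (simp add: left_diff_distrib)
qed simp

lemma geometric_factor_right: "(\<Sum>j<n. u ^ j) * (1 - u) = 1 - (u::'a::ring_1) ^ n"
proof (induction n)
  case (Suc n)
  have "(\<Sum>j<Suc n. u ^ j) * (1 - u) = 1 - u ^ n + u ^ n * (1 - u)"
    by (simp only: sum.lessThan_Suc distrib_right Suc)
  then show ?case by (simp add: right_diff_distrib power_commutes)
qed simp

text \<open>The geometric sum makes \<open>1 - u\<close> a factor of the invertible
  \<open>1 - u ^ k\<close> from either side, which gives a left and a right inverse; these must
  agree.\<close>

lemma inverse_if_power_in_jacobson_radical: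
  assumes "u ^ k \<in> jacobson_radical"
  shows "\<exists>h. h * (1 - u) = 1 \<and> (1 - u) * h = 1"
proof -
  let ?s = "\<Sum>j<k. u ^ j"
  obtain h where h: "h * (1 - u ^ k) = 1" "(1 - u ^ k) * h = 1"
    using jacobson_radical_inverse[OF assms] by blast
  have l: "(h * ?s) * (1 - u) = 1" by (simp add: mult.assoc geometric_factor_right h)
  have r: "(1 - u) * (?s * h) = 1" by (simp add: mult.assoc[symmetric] geometric_factor_left h)
  have "?s * h = (h * ?s) * (1 - u) * (?s * h)" using l by simp
  also have "\<dots> = h * ?s" using r by (simp only: mult.assoc mult_1_right)
  finally show ?thesis using l r by metis
qed

section \<open>Complex scalars\<close>

lemma scaleC_one [simp]: "1 *\<^sub>C x = x"
  using scaleC_of_real[of 1 x] by simp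

lemma additive_scaleC_left: "Modules.additive (\<lambda>c. c *\<^sub>C x)"
  by standard (rule scaleC_add_left)

lemmas scaleC_sum_left = Modules.additive.sum[OF additive_scaleC_left]
  and scaleC_zero_left [simp] = Modules.additive.zero[OF additive_scaleC_left]
  and scaleC_diff_left = Modules.additive.diff[OF additive_scaleC_left]

lemma scaleC_power: "(c *\<^sub>C x) ^ n = c ^ n *\<^sub>C x ^ n"
  by (induction n) (simp_all add: mult_scaleC_left mult_scaleC_right scaleC_scaleC mult.commute)

lemma scaleR_power_algebra: "(r *\<^sub>R x) ^ n = r ^ n *\<^sub>R (x::'a::real_algebra_1) ^ n"
  by (induction n) simp_all

lemma jacobson_radical_scaleC: "z \<in> jacobson_radical \<Longrightarrow> c *\<^sub>C z \<in> jacobson_radical"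
  using jacobson_radical_mult_left[of z "c *\<^sub>C 1"] by (simp add: mult_scaleC_left)

lemma eq_scaleC_swap: "x = c *\<^sub>C y \<Longrightarrow> c \<noteq> 0 \<Longrightarrow> y = inverse c *\<^sub>C x"
  by (simp add: scaleC_scaleC)

lemma power_commute_up_to_scalar:
  assumes "a * b = c *\<^sub>C (b * a)"
  shows "a ^ n * b = c ^ n *\<^sub>C (b * a ^ n)"
proof (induction n)
  case (Suc n)
  have "a ^ Suc n * b = a ^ n * (a * b)" by (simp add: power_Suc2 mult.assoc del: power_Suc)
  also have "\<dots> = c *\<^sub>C ((a ^ n * b) * a)" by (simp add: assms mult_scaleC_right mult.assoc)
  also have "\<dots> = c ^ Suc n *\<^sub>C (b * a ^ Suc n)"
    by (simp add: Suc mult_scaleC_left scaleC_scaleC power_Suc2 mult.assoc del: power_Suc)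
       (simp add: mult.commute)
  finally show ?case .
qed simp

text \<open>As \<open>norm 1 = 1\<close> is not assumed,
  \<open>norm (x ^ n) \<le> norm x ^ n\<close> can fail at \<open>n = 0\<close>. Carrying the factor
  \<open>w\<close> along covers all \<open>n\<close>.\<close>

lemma norm_power_mult_le: "norm (x ^ n * w) \<le> norm x ^ n * norm (w::'a::{real_normed_algebra,monoid_mult})"
proof (induction n)
  case (Suc n)
  have "norm (x ^ Suc n * w) \<le> norm x * norm (x ^ n * w)"
    by (simp add: mult.assoc norm_mult_ineq)
  also have "\<dots> \<le> norm x * (norm x ^ n * norm w)" by (intro mult_left_mono Suc) simp
  finally show ?case by (simp add: mult.assoc)
qed simp

lemma norm_mult_power_le: "norm (w * x ^ n) \<le> norm w * norm (x::'a::{real_normed_algebra,monoid_mult}) ^ n"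
proof (induction n)
  case (Suc n)
  have "norm (w * x ^ Suc n) \<le> norm (w * x ^ n) * norm x"
    by (simp only: power_Suc2 mult.assoc[symmetric] norm_mult_ineq)
  also have "\<dots> \<le> norm w * norm x ^ n * norm x" by (intro mult_right_mono Suc) simp
  finally show ?case by (simp only: power_Suc2 mult.assoc)
qed simp

section \<open>Quasinilpotence\<close>

lemma cis_root_of_unity: "n > 0 \<Longrightarrow> cis (2 * pi / real n) ^ n = 1"
  by (subst Complex.DeMoivre) simp

text \<open>For \<open>0 < j < n\<close> the number \<open>cis (2 * pi / n) ^ j\<close> is an
  \<open>n\<close>-th root of unity other than 1, so its geometric sum of length \<open>n\<close>
  vanishes.\<close>

lemma sum_powers_root_of_unity:
  fixes n j :: nat
  assumes "j < n"
  shows "(\<Sum>k<n. (cis (2 * pi / n) ^ k) ^ j) = (if j = 0 then of_nat n else 0)"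
proof (cases "j = 0")
  case False
  let ?w = "cis (2 * pi / n)"
  have n: "n > 0" using assms by simp
  have "?w ^ j = exp (2 * of_real pi * \<i> * of_nat j / of_nat n)"
    by (subst Complex.DeMoivre) (simp add: cis_conv_exp mult_ac)
  then have "?w ^ j \<noteq> 1"
    using complex_root_unity_eq_1[of n j] n assms False by (auto dest: dvd_imp_le)
  moreover have "?w ^ n = 1" using n by (rule cis_root_of_unity)
  then have "(?w ^ j) ^ n = 1" by (metis power_mult mult.commute power_one)
  ultimately have "(\<Sum>k<n. (?w ^ j) ^ k) = 0" by (simp add: sum_gp_strict)
  then show ?thesis using False by (simp add: power_mult[symmetric] mult.commute)
qed simp

text \<open>Multiplying \<open>u\<close> by a root of unity leaves \<open>u ^ n\<close> unchanged,
  so \<open>F k * (1 - u ^ n)\<close> is a geometric sum in the rotated \<open>u\<close>. Summing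
  over \<open>k\<close> cancels every power of \<open>u\<close> except the constant one.\<close>

lemma sum_resolvents_roots_of_unity:
  fixes u :: "'a::complex_banach_algebra_1"
  assumes n: "n > 0"
    and F: "\<And>k. F k * (1 - (cis (2 * pi / n) ^ k) *\<^sub>C u) = 1"
  shows "(\<Sum>k<n. F k) * (1 - u ^ n) = of_nat n"
proof -
  let ?w = "cis (2 * pi / n)"
  have wn: "?w ^ n = 1" using n by (rule cis_root_of_unity)
  have "F k * (1 - u ^ n) = (\<Sum>j<n. (?w ^ k) ^ j *\<^sub>C u ^ j)" for k
  proof -
    have "(?w ^ k) ^ n = 1" using wn by (metis power_mult mult.commute power_one)
    then have "1 - u ^ n = 1 - (?w ^ k *\<^sub>C u) ^ n" by (simp add: scaleC_power)
    also have "\<dots> = (1 - ?w ^ k *\<^sub>C u) * (\<Sum>j<n. (?w ^ k *\<^sub>C u) ^ j)"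
      by (simp add: geometric_factor_left)
    finally have "F k * (1 - u ^ n) = (\<Sum>j<n. (?w ^ k *\<^sub>C u) ^ j)"
      by (metis F mult.assoc mult_1)
    then show ?thesis by (simp add: scaleC_power)
  qed
  then have "(\<Sum>k<n. F k) * (1 - u ^ n) = (\<Sum>k<n. \<Sum>j<n. (?w ^ k) ^ j *\<^sub>C u ^ j)"
    by (simp add: sum_distrib_right)
  also have "\<dots> = (\<Sum>j<n. \<Sum>k<n. (?w ^ k) ^ j *\<^sub>C u ^ j)" by (rule sum.swap)
  also have "\<dots> = (\<Sum>j<n. (\<Sum>k<n. (?w ^ k) ^ j) *\<^sub>C u ^ j)" by (simp add: scaleC_sum_left)
  also have "\<dots> = (\<Sum>j<n. if j = 0 then of_nat n *\<^sub>C 1 else 0)"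
    by (intro sum.cong refl) (simp add: sum_powers_root_of_unity)
  also have "\<dots> = of_nat n *\<^sub>C 1" using n by simp
  also have "\<dots> = of_nat n" using scaleC_of_real[of "real n" "1::'a"] by (simp add: scaleR_conv_of_real)
  finally show ?thesis .
qed

text \<open>The resolvent identity \<open>diff\<close> reduces continuity at \<open>c\<close> to a
  bound on \<open>F d\<close> for \<open>d\<close> near \<open>c\<close>.\<close>

lemma resolvent_continuous_on:
  fixes z :: "'a::complex_banach_algebra_1"
  assumes F: "\<And>c. F c * (1 - c *\<^sub>C z) = 1" "\<And>c. (1 - c *\<^sub>C z) * F c = 1"
  shows "continuous_on S F"
proof (rule continuous_at_imp_continuous_on, intro ballI)
  fix c
  let ?K = "norm (F c) * norm z"
  have diff: "F d - F c = (d - c) *\<^sub>C (F c * z * F d)" for d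
  proof -
    have "F d - F c = F c * (1 - c *\<^sub>C z) * F d - F c * ((1 - d *\<^sub>C z) * F d)"
      using F by simp
    also have "\<dots> = F c * ((1 - c *\<^sub>C z) - (1 - d *\<^sub>C z)) * F d" by (simp add: algebra_simps)
    also have "(1 - c *\<^sub>C z) - (1 - d *\<^sub>C z) = (d - c) *\<^sub>C z" by (simp add: scaleC_diff_left)
    finally show ?thesis by (simp add: mult_scaleC_left mult_scaleC_right)
  qed
  have le: "norm (F d - F c) \<le> cmod (d - c) * (?K * norm (F d))" for d
    unfolding diff norm_scaleC
    by (intro mult_left_mono order.trans[OF norm_mult_ineq] mult_right_mono norm_mult_ineq) simp_all
  have lim0: "((\<lambda>d. cmod (d - c) * t) \<longlongrightarrow> 0) (at c)" for t
  proof -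
    have "((\<lambda>d. cmod (d - c) * t) \<longlongrightarrow> cmod (c - c) * t) (at c)" by (intro tendsto_intros)
    then show ?thesis by simp
  qed
  \<comment> \<open>For such \<open>d\<close> the estimate \<open>le\<close> gives
    \<open>norm (F d) \<le> norm (F c) + norm (F d) / 2\<close>, so \<open>norm (F d)\<close> is at
    most twice \<open>norm (F c)\<close>.\<close>
  have "eventually (\<lambda>d. cmod (d - c) * ?K < 1 / 2) (at c)"
    using order_tendstoD(2)[OF lim0[of ?K], of "1/2"] by simp
  then have "eventually (\<lambda>d. norm (F d - F c) \<le> cmod (d - c) * (?K * (2 * norm (F c)))) (at c)"
  proof eventually_elim
    case (elim d)
    have "norm (F d) \<le> norm (F c) + norm (F d - F c)" by (metis norm_triangle_sub)
    also have "norm (F d - F c) \<le> (cmod (d - c) * ?K) * norm (F d)"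
      using le[of d] by (simp add: mult.assoc)
    also have "\<dots> \<le> 1 / 2 * norm (F d)" by (intro mult_right_mono) (use elim in auto)
    finally have "norm (F d) \<le> 2 * norm (F c)" by simp
    then have "cmod (d - c) * (?K * norm (F d)) \<le> cmod (d - c) * (?K * (2 * norm (F c)))"
      by (intro mult_left_mono) auto
    then show ?case using le[of d] by linarith
  qed
  then have "((\<lambda>d. F d - F c) \<longlongrightarrow> 0) (at c)"
    by (rule Lim_null_comparison) (rule lim0)
  then show "isCont F c" unfolding isCont_def by (simp add: LIM_zero_iff)
qed

text \<open>Trades mere boundedness at \<open>s\<close> for convergence at a smaller
  \<open>t\<close>: the powers shrink by the geometric factor \<open>(t / s) ^ n\<close>.\<close>

lemma powers_tendsto_zero_if_smaller:
  fixes z :: "'a::complex_banach_algebra_1"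
  assumes "0 \<le> t" "t < s" and B: "eventually (\<lambda>n. norm ((s *\<^sub>R z) ^ n) \<le> B) sequentially"
  shows "(\<lambda>n. (t *\<^sub>R z) ^ n) \<longlonglongrightarrow> 0"
proof (rule Lim_null_comparison)
  show "(\<lambda>n. (t / s) ^ n * B) \<longlonglongrightarrow> 0"
    using assms(1,2) by (intro tendsto_mult_left_zero LIMSEQ_power_zero) auto
  show "eventually (\<lambda>n. norm ((t *\<^sub>R z) ^ n) \<le> (t / s) ^ n * B) sequentially"
    using B
  proof eventually_elim
    case (elim n)
    have "t *\<^sub>R z = (t / s) *\<^sub>R (s *\<^sub>R z)" using assms(1,2) by simp
    then have "(t *\<^sub>R z) ^ n = (t / s) ^ n *\<^sub>R (s *\<^sub>R z) ^ n" by (metis scaleR_power_algebra)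
    then have "norm ((t *\<^sub>R z) ^ n) = (t / s) ^ n * norm ((s *\<^sub>R z) ^ n)"
      using assms(1,2) by simp
    also have "\<dots> \<le> (t / s) ^ n * B" using elim assms(1,2) by (intro mult_left_mono) auto
    finally show ?case .
  qed
qed

text \<open>Convergence spreads from 0 to \<open>r\<close> in finitely many steps of fixed length.
  If it holds at \<open>t\<close>, the averages at \<open>t\<close> approach 1; by equicontinuity
  those at a nearby \<open>s\<close> stay close to 1, and so their inverses
  \<open>1 - (s *\<^sub>R z) ^ n\<close> stay bounded.\<close>

lemma quasinilpotent_if_resolvent_entire:
  fixes z :: "'a::complex_banach_algebra_1"
  assumes inv: "\<And>c. \<exists>h. h * (1 - c *\<^sub>C z) = 1 \<and> (1 - c *\<^sub>C z) * h = 1" and "0 \<le> r"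
  shows "(\<lambda>n. (r *\<^sub>R z) ^ n) \<longlonglongrightarrow> 0"
proof -
  obtain F where F: "\<And>c. F c * (1 - c *\<^sub>C z) = 1" "\<And>c. (1 - c *\<^sub>C z) * F c = 1"
    using inv by metis
  \<comment> \<open>The margin of 1, together with \<open>\<delta> \<le> 1\<close> below, keeps the
    overshoot \<open>t + \<delta> / 4\<close> of any \<open>t \<le> r\<close> inside the disc on
    which \<open>F\<close> is controlled.\<close>
  define R where "R = r + 1"
  have cont: "continuous_on (cball 0 R) F" by (rule resolvent_continuous_on[OF F])
  have "bounded (F ` cball 0 R)" by (intro compact_imp_bounded compact_continuous_image cont) simp
  then obtain B where B: "\<And>c. cmod c \<le> R \<Longrightarrow> norm (F c) \<le> B"
    unfolding bounded_iff by (metis image_eqI mem_cball_0)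
  have "uniformly_continuous_on (cball 0 R) F"
    by (intro compact_uniformly_continuous cont) simp
  then obtain \<delta>' where "\<delta>' > 0" and
    \<delta>': "\<And>c d. cmod c \<le> R \<Longrightarrow> cmod d \<le> R \<Longrightarrow> cmod (d - c) < \<delta>' \<Longrightarrow> norm (F d - F c) < 1/4"
    unfolding uniformly_continuous_on_def dist_norm by (force dest: spec[of _ "1/4"])
  define \<delta> where "\<delta> = min \<delta>' 1"
  have \<delta>: "0 < \<delta>" "\<delta> \<le> 1" "\<delta> \<le> \<delta>'" using \<open>\<delta>' > 0\<close> unfolding \<delta>_def by auto
  define G where
    "G n s = (1 / real n) *\<^sub>R (\<Sum>k<n. F (cis (2 * pi / n) ^ k * complex_of_real s))" for n :: nat and s
  have mod_eq: "cmod (cis (2 * pi / n) ^ k * v) = cmod v" for n k :: nat and v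
    by (simp add: norm_mult norm_power)
  have G_inv: "G n s * (1 - (s *\<^sub>R z) ^ n) = 1" if "n > 0" for n s
  proof -
    have "F (cis (2 * pi / n) ^ k * complex_of_real s)
        * (1 - cis (2 * pi / n) ^ k *\<^sub>C (s *\<^sub>R z)) = 1" for k
      using F(1)[of "cis (2 * pi / n) ^ k * complex_of_real s"]
      by (simp only: scaleC_of_real[symmetric] scaleC_scaleC)
    from sum_resolvents_roots_of_unity[OF that this]
    have "(\<Sum>k<n. F (cis (2 * pi / n) ^ k * complex_of_real s)) * (1 - (s *\<^sub>R z) ^ n) = of_nat n" .
    then have "G n s * (1 - (s *\<^sub>R z) ^ n) = (1 / real n) *\<^sub>R of_nat n"
      unfolding G_def by (simp only: mult_scaleR_left)
    moreover have "(of_nat n :: 'a) = real n *\<^sub>R 1" by (simp add: scaleR_conv_of_real)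
    ultimately show ?thesis using that by simp
  qed
  \<comment> \<open>\<open>F c\<close> inverts an element that commutes with \<open>z ^ n\<close>,
    so it commutes with \<open>z ^ n\<close> as well; hence the left inverse \<open>G n s\<close> is
    two-sided.\<close>
  have G_inv': "(1 - (s *\<^sub>R z) ^ n) * G n s = 1" if "n > 0" for n s
  proof -
    let ?u = "s *\<^sub>R z"
    have comm: "(1 - ?u ^ n) * F c = F c * (1 - ?u ^ n)" for c
    proof -
      have "z ^ n * (1 - c *\<^sub>C z) = (1 - c *\<^sub>C z) * z ^ n"
        by (simp add: algebra_simps mult_scaleC_left mult_scaleC_right power_commutes)
      moreover have "F c * (z ^ n * (1 - c *\<^sub>C z)) * F c = F c * z ^ n"
        by (simp only: mult.assoc F mult_1_right)
      moreover have "F c * ((1 - c *\<^sub>C z) * z ^ n) * F c = z ^ n * F c"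
        by (simp only: mult.assoc[symmetric] F mult_1_left)
      ultimately have "F c * z ^ n = z ^ n * F c" by simp
      then show ?thesis by (simp add: algebra_simps scaleR_power_algebra)
    qed
    have "(1 - ?u ^ n) * G n s = G n s * (1 - ?u ^ n)"
      unfolding G_def by (simp add: sum_distrib_left sum_distrib_right comm)
    then show ?thesis using G_inv[OF that] by simp
  qed
  have G_bound: "norm (G n s) \<le> B" if "n > 0" "0 \<le> s" "s \<le> R" for n s
  proof -
    have "norm (\<Sum>k<n. F (cis (2 * pi / n) ^ k * complex_of_real s)) \<le> real (card {..<n}) * B"
      using that by (intro sum_norm_bound B) (simp add: mod_eq)
    then show ?thesis using that unfolding G_def by (simp add: field_simps)
  qed
  \<comment> \<open>Rotation by a root of unity preserves the distance of \<open>s\<close> and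
    \<open>t\<close>, so one \<open>\<delta>\<close> serves every term of the average and every
    \<open>n\<close>.\<close>
  have G_diff: "norm (G n s - G n t) \<le> 1/4"
    if "n > 0" "0 \<le> s" "s \<le> R" "0 \<le> t" "t \<le> R" "\<bar>s - t\<bar> < \<delta>" for n s t
  proof -
    let ?w = "cis (2 * pi / n)"
    have "norm (F (?w ^ k * complex_of_real s) - F (?w ^ k * complex_of_real t)) \<le> 1/4" for k
    proof (rule less_imp_le, rule \<delta>')
      have "?w ^ k * complex_of_real s - ?w ^ k * complex_of_real t = ?w ^ k * complex_of_real (s - t)"
        by (simp add: algebra_simps)
      then show "cmod (?w ^ k * complex_of_real s - ?w ^ k * complex_of_real t) < \<delta>'"
        using that \<delta>(3) by (simp only: mod_eq norm_of_real)
    qed (use that in \<open>simp_all add: mod_eq\<close>)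
    then have "norm (\<Sum>k<n. F (?w ^ k * complex_of_real s) - F (?w ^ k * complex_of_real t))
        \<le> real (card {..<n}) * (1/4)"
      by (intro sum_norm_bound)
    moreover have "G n s - G n t
        = (1 / real n) *\<^sub>R (\<Sum>k<n. F (?w ^ k * complex_of_real s) - F (?w ^ k * complex_of_real t))"
      unfolding G_def by (simp add: sum_subtractf scaleR_diff_right)
    ultimately show ?thesis using that(1) by (simp add: field_simps)
  qed
  have step: "eventually (\<lambda>n. norm ((s *\<^sub>R z) ^ n) \<le> 3 * norm (1::'a)) sequentially"
    if st: "0 \<le> s" "s \<le> R" "0 \<le> t" "t \<le> R" "\<bar>s - t\<bar> < \<delta>" and lim: "(\<lambda>n. (t *\<^sub>R z) ^ n) \<longlonglongrightarrow> 0" for s t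
  proof -
    have "(\<lambda>n. B * norm ((t *\<^sub>R z) ^ n)) \<longlonglongrightarrow> 0"
      using tendsto_mult_left[OF tendsto_norm[OF lim], of B] by simp
    then have "eventually (\<lambda>n. B * norm ((t *\<^sub>R z) ^ n) < 1/4) sequentially"
      by (rule order_tendstoD) simp
    then show ?thesis using eventually_gt_at_top[of 0]
    proof eventually_elim
      case (elim n)
      let ?h = "1 - (s *\<^sub>R z) ^ n"
      have "G n t - 1 = G n t * (t *\<^sub>R z) ^ n"
        using G_inv[OF elim(2), of t] by (simp add: algebra_simps)
      also have "norm \<dots> \<le> norm (G n t) * norm ((t *\<^sub>R z) ^ n)" by (rule norm_mult_ineq)
      also have "\<dots> \<le> B * norm ((t *\<^sub>R z) ^ n)"
        by (intro mult_right_mono G_bound) (use elim st in auto)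
      finally have 1: "norm (G n t - 1) \<le> 1/4" using elim(1) by simp
      have "norm (G n s - 1) \<le> norm (G n s - G n t) + norm (G n t - 1)"
        using norm_triangle_ineq[of "G n s - G n t" "G n t - 1"] by simp
      then have G1: "norm (G n s - 1) \<le> 1/2" using G_diff[OF elim(2) st] 1 by linarith
      \<comment> \<open>Since \<open>G n s\<close> is within 1/2 of 1, the last term has norm at
        most half that of \<open>?h\<close> and can be absorbed on the left.\<close>
      have "?h = 1 - ?h * (G n s - 1)"
        using G_inv'[OF elim(2), of s] by (simp add: right_diff_distrib)
      then have "norm ?h \<le> norm (1::'a) + norm (?h * (G n s - 1))"
        by (metis norm_triangle_ineq4)
      also have "norm (?h * (G n s - 1)) \<le> norm ?h * norm (G n s - 1)" by (rule norm_mult_ineq)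
      also have "\<dots> \<le> norm ?h * (1/2)" using G1 by (intro mult_left_mono) auto
      finally have "norm ?h \<le> 2 * norm (1::'a)" by simp
      moreover have "norm ((s *\<^sub>R z) ^ n) \<le> norm (1::'a) + norm ?h"
        using norm_triangle_ineq4[of 1 ?h] by simp
      ultimately show ?case by linarith
    qed
  qed
  have "\<forall>t. 0 \<le> t \<and> t \<le> r \<and> t \<le> real m * (\<delta> / 4) \<longrightarrow> (\<lambda>n. (t *\<^sub>R z) ^ n) \<longlonglongrightarrow> 0" for m
  proof (induction m)
    case 0
    \<comment> \<open>The sequence is zero only from index 1 on, because
      \<open>0 ^ 0 = 1\<close>.\<close>
    have "(\<lambda>n. (0::'a) ^ n) \<longlonglongrightarrow> 0"
      by (rule tendsto_eventually) (auto simp: eventually_sequentially power_0_left intro!: exI[of _ 1])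
    then show ?case by (metis antisym mult_zero_left of_nat_0 scaleR_zero_left)
  next
    case (Suc m)
    show ?case
    proof (intro allI impI)
      fix t assume t: "0 \<le> t \<and> t \<le> r \<and> t \<le> real (Suc m) * (\<delta> / 4)"
      \<comment> \<open>From \<open>?t\<close>, covered by the induction hypothesis,
        \<open>step\<close> reaches \<open>t + \<delta> / 4\<close>, at distance at most
        \<open>\<delta> / 2\<close>. It yields only boundedness there, and falling back to
        \<open>t\<close> turns this into convergence.\<close>
      let ?t = "max 0 (t - \<delta> / 4)"
      have "0 \<le> real m * (\<delta> / 4)" using \<delta> by simp
      moreover have "t - \<delta> / 4 \<le> real m * (\<delta> / 4)" using t by (simp add: field_simps)
      ultimately have "?t \<le> real m * (\<delta> / 4)" by (rule max.boundedI)
      then have lim: "(\<lambda>n. (?t *\<^sub>R z) ^ n) \<longlonglongrightarrow> 0" using Suc t \<delta> by auto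
      have "eventually (\<lambda>n. norm (((t + \<delta> / 4) *\<^sub>R z) ^ n) \<le> 3 * norm (1::'a)) sequentially"
        by (rule step[OF _ _ _ _ _ lim]) (use t \<delta> in \<open>auto simp: R_def\<close>)
      then show "(\<lambda>n. (t *\<^sub>R z) ^ n) \<longlonglongrightarrow> 0"
        by (intro powers_tendsto_zero_if_smaller[of t "t + \<delta> / 4"]) (use t \<delta> in auto)
    qed
  qed
  moreover obtain m :: nat where "r / (\<delta> / 4) \<le> real m" using real_arch_simple by blast
  then have "r \<le> real m * (\<delta> / 4)" using \<delta> by (simp add: field_simps)
  ultimately show ?thesis using \<open>0 \<le> r\<close> by blast
qed

text \<open>Every scalar multiple of \<open>z\<close> also has its \<open>k\<close>-th power in the
  radical, so \<open>1 - c *\<^sub>C z\<close> is invertible for all \<open>c\<close>.\<close>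

lemma quasinilpotent_if_power_in_jacobson_radical:
  fixes z :: "'a::complex_banach_algebra_1"
  assumes "z ^ k \<in> jacobson_radical" "0 \<le> r"
  shows "(\<lambda>n. r ^ n * norm (z ^ n)) \<longlonglongrightarrow> 0"
proof -
  have "(\<lambda>n. (r *\<^sub>R z) ^ n) \<longlonglongrightarrow> 0"
    using assms
    by (intro quasinilpotent_if_resolvent_entire inverse_if_power_in_jacobson_radical[of _ k])
       (simp_all add: scaleC_power jacobson_radical_scaleC)
  from tendsto_norm[OF this] show ?thesis using assms(2) by (simp add: scaleR_power_algebra)
qed

section \<open>p-Drazin inverses\<close>

lemma power_mult_distrib_commuting:
  assumes "x * y = y * (x::'a::monoid_mult)"
  shows "(x * y) ^ n = x ^ n * y ^ n"
proof (induction n)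
  case (Suc n)
  have "y * x ^ n = x ^ n * y" using power_commuting_commutes[OF assms] by simp
  then have "x * y * (x ^ n * y ^ n) = x * x ^ n * (y * y ^ n)" by (metis mult.assoc)
  then show ?case by (simp add: Suc)
qed simp

lemma idempotent_complement_power:
  fixes a p :: "'a::ring_1"
  assumes "a * p = p * a" "p * p = p" "n > 0"
  shows "(a * (1 - p)) ^ n = a ^ n * (1 - p)"
  using assms(3)
proof (induction n rule: nat_induct_non_zero)
  case (Suc n)
  have "(1 - p) * (1 - p) = 1 - p" using assms(2) by (simp add: algebra_simps)
  moreover have "(1 - p) * a ^ n = a ^ n * (1 - p)"
    using power_commuting_commutes[of a p n] assms(1) by (simp add: algebra_simps)
  ultimately show ?case
    by (simp add: Suc) (metis mult.assoc)
qed simp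

text \<open>\<open>a * x\<close> is the idempotent on whose corner \<open>a\<close> is invertible
  with inverse \<open>x\<close>. The last clause rewrites the radical condition through the
  complementary idempotent.\<close>

lemma p_drazin_projection:
  fixes a x :: "'a::ring_1"
  assumes "is_p_drazin_inverse a x"
  shows "a * x * (a * x) = a * x" "a * (a * x) = a * x * a" "x * (a * x) = x" "a * x * x = x"
    "n > 0 \<Longrightarrow> a ^ n * x ^ n = a * x" "n > 0 \<Longrightarrow> x ^ n * a ^ n = a * x"
    "\<exists>k>0. a ^ k * (1 - a * x) \<in> jacobson_radical"
proof -
  have c: "a * x = x * a" and x: "x * a * x = x"
    and k: "\<exists>k\<ge>1. a ^ k - a ^ (k + 1) * x \<in> jacobson_radical"
    using assms unfolding is_p_drazin_inverse_def by auto
  show pp: "a * x * (a * x) = a * x" using x by (simp add: mult.assoc)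
  show "a * (a * x) = a * x * a" by (metis c mult.assoc)
  show "x * (a * x) = x" using x by (simp add: mult.assoc)
  show "a * x * x = x" using x c by simp
  have pn: "(a * x) ^ n = a * x" if "n > 0" for n
    using that by (induction n rule: nat_induct_non_zero) (simp_all add: pp)
  show "a ^ n * x ^ n = a * x" if "n > 0"
    using pn[OF that] power_mult_distrib_commuting[OF c] by simp
  show "x ^ n * a ^ n = a * x" if "n > 0"
    using pn[OF that] power_mult_distrib_commuting[OF c[symmetric]] c by simp
  have "a ^ k * (1 - a * x) = a ^ k - a ^ (k + 1) * x" for k
    by (simp add: right_diff_distrib power_Suc2 mult.assoc del: power_Suc)
  then show "\<exists>k>0. a ^ k * (1 - a * x) \<in> jacobson_radical" using k by (metis Suc_le_eq One_nat_def)
qed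

lemma p_drazin_projection_commutes:
  fixes a b x :: "'a::complex_banach_algebra_1"
  assumes x: "is_p_drazin_inverse a x" and "\<mu> \<noteq> 0" and ab: "a * b = \<mu> *\<^sub>C (b * a)"
  shows "a * x * b = b * (a * x)"
proof -
  define p where "p = a * x"
  define z where "z = a * (1 - p)"
  note proj = p_drazin_projection[OF x, folded p_def]
  have ap: "a * (1 - p) = (1 - p) * a" using proj(2) by (simp add: algebra_simps)
  have zn: "z ^ n = a ^ n * (1 - p)" if "n > 0" for n
    unfolding z_def using that proj(1,2) by (intro idempotent_complement_power) auto
  have zn': "z ^ n = (1 - p) * a ^ n" if "n > 0" for n
    using zn[OF that] power_commuting_commutes[OF ap, of n] by simp
  obtain k where "z ^ k \<in> jacobson_radical" using proj(7) zn by metis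
  note small = quasinilpotent_if_power_in_jacobson_radical[OF this]
  have swap: "a ^ n * b = \<mu> ^ n *\<^sub>C (b * a ^ n)" for n
    by (rule power_commute_up_to_scalar[OF ab])
  have swap': "b * a ^ n = inverse \<mu> ^ n *\<^sub>C (a ^ n * b)" for n
    using eq_scaleC_swap[OF swap[of n]] \<open>\<mu> \<noteq> 0\<close> by (simp add: power_inverse)
  have "p * b * (1 - p) = 0"
  proof -
    \<comment> \<open>The left side does not depend on \<open>n\<close>, while the right side tends
      to 0 by \<open>small\<close>, taken at \<open>cmod \<mu> * norm x\<close>.\<close>
    have "norm (p * b * (1 - p)) \<le> (cmod \<mu> * norm x) ^ n * norm (z ^ n) * norm b" if "n > 0" for n
    proof -
      have "p * b * (1 - p) = x ^ n * (a ^ n * b) * (1 - p)"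
        by (simp add: proj(6)[OF that, symmetric] mult.assoc)
      also have "\<dots> = \<mu> ^ n *\<^sub>C (x ^ n * (b * z ^ n))"
        by (simp add: swap zn[OF that] mult_scaleC_left mult_scaleC_right mult.assoc)
      also have "norm \<dots> = cmod \<mu> ^ n * norm (x ^ n * (b * z ^ n))"
        by (simp add: norm_scaleC norm_power)
      also have "\<dots> \<le> cmod \<mu> ^ n * (norm x ^ n * (norm b * norm (z ^ n)))"
        by (intro mult_left_mono order.trans[OF norm_power_mult_le] norm_mult_ineq) auto
      finally show ?thesis by (simp add: power_mult_distrib mult_ac)
    qed
    then have "eventually (\<lambda>n. norm (p * b * (1 - p))
        \<le> (cmod \<mu> * norm x) ^ n * norm (z ^ n) * norm b) sequentially"
      by (intro eventually_mono[OF eventually_gt_at_top[of 0]])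
    moreover have "(\<lambda>n. (cmod \<mu> * norm x) ^ n * norm (z ^ n) * norm b) \<longlonglongrightarrow> 0"
      by (intro tendsto_mult_left_zero small) simp
    ultimately have "norm (p * b * (1 - p)) \<le> 0" by (intro tendsto_lowerbound) auto
    then show ?thesis by simp
  qed
  moreover have "(1 - p) * b * p = 0"
  proof -
    \<comment> \<open>The mirror image: now \<open>p\<close> is expanded as
      \<open>a ^ n * x ^ n\<close>, and moving \<open>a ^ n\<close> to the left of \<open>b\<close>
      costs powers of \<open>inverse \<mu>\<close>.\<close>
    have "norm ((1 - p) * b * p) \<le> (cmod (inverse \<mu>) * norm x) ^ n * norm (z ^ n) * norm b"
      if "n > 0" for n
    proof -
      have "(1 - p) * b * p = (1 - p) * (b * a ^ n) * x ^ n"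
        by (simp add: proj(5)[OF that, symmetric] mult.assoc)
      also have "\<dots> = inverse \<mu> ^ n *\<^sub>C (z ^ n * b * x ^ n)"
        by (simp add: swap' zn'[OF that] mult_scaleC_left mult_scaleC_right mult.assoc)
      also have "norm \<dots> = cmod (inverse \<mu>) ^ n * norm (z ^ n * b * x ^ n)"
        by (simp only: norm_scaleC norm_power)
      also have "\<dots> \<le> cmod (inverse \<mu>) ^ n * (norm (z ^ n) * norm b * norm x ^ n)"
        by (intro mult_left_mono order.trans[OF norm_mult_power_le] mult_right_mono norm_mult_ineq) auto
      finally show ?thesis by (simp add: power_mult_distrib mult_ac)
    qed
    then have "eventually (\<lambda>n. norm ((1 - p) * b * p)
        \<le> (cmod (inverse \<mu>) * norm x) ^ n * norm (z ^ n) * norm b) sequentially"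
      by (intro eventually_mono[OF eventually_gt_at_top[of 0]])
    moreover have "(\<lambda>n. (cmod (inverse \<mu>) * norm x) ^ n * norm (z ^ n) * norm b) \<longlonglongrightarrow> 0"
      by (intro tendsto_mult_left_zero small) simp
    ultimately have "norm ((1 - p) * b * p) \<le> 0" by (intro tendsto_lowerbound) auto
    then show ?thesis by simp
  qed
  \<comment> \<open>Both sides are zero; expanding, the common term \<open>p * b * p\<close>
    cancels.\<close>
  ultimately have "p * b * (1 - p) = (1 - p) * b * p" by simp
  then have "p * b = b * p" by (simp add: right_diff_distrib left_diff_distrib)
  then show ?thesis by (simp add: p_def)
qed

text \<open>Inserting \<open>a * x\<close>, which commutes with \<open>b\<close>, produces
  \<open>a * b\<close> between two copies of \<open>x\<close>, where the relation applies. With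
  \<open>\<mu> = 1\<close> this says that \<open>x\<close> commutes with whatever commutes with
  \<open>a\<close>.\<close>

lemma p_drazin_inverse_commute_up_to_scalar:
  fixes a b x :: "'a::complex_banach_algebra_1"
  assumes x: "is_p_drazin_inverse a x" and "\<mu> \<noteq> 0" and ab: "a * b = \<mu> *\<^sub>C (b * a)"
  shows "b * x = \<mu> *\<^sub>C (x * b)"
proof -
  note proj = p_drazin_projection[OF x]
  have pb: "a * x * b = b * (a * x)" by (rule p_drazin_projection_commutes[OF assms])
  have c: "a * x = x * a" using x unfolding is_p_drazin_inverse_def by simp
  have "b * x = b * (a * x) * x" using proj(4) by (simp add: mult.assoc)
  also have "\<dots> = x * (a * b) * x" by (simp only: pb[symmetric]) (simp only: c mult.assoc)
  also have "\<dots> = \<mu> *\<^sub>C (x * (b * (a * x)))"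
    by (simp add: ab mult_scaleC_left mult_scaleC_right mult.assoc)
  also have "x * (b * (a * x)) = x * (a * x) * b" by (simp only: pb[symmetric]) (simp only: mult.assoc)
  also have "\<dots> = x * b" by (simp only: proj(3))
  finally show ?thesis .
qed

text \<open>The product of these commuting idempotents is idempotent, and it equals
  \<open>x ^ k * (a ^ k * (1 - a * y))\<close>, which lies in the radical for suitable
  \<open>k\<close>; hence it vanishes.\<close>

lemma p_drazin_projection_mult_complement:
  fixes a x q :: "'a::complex_banach_algebra_1"
  assumes x: "is_p_drazin_inverse a x" and y: "is_p_drazin_inverse a y" and "x * y = y * x"
  shows "a * x * (1 - a * y) = 0"
proof -
  let ?p = "a * x" and ?q = "a * y"
  have cx: "a * x = x * a" and cy: "a * y = y * a"
    using x y unfolding is_p_drazin_inverse_def by auto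
  have "?p * ?q = ?q * ?p" by (metis assms(3) cx cy mult.assoc)
  then have "?p * (1 - ?q) = (1 - ?q) * ?p" by (simp add: right_diff_distrib left_diff_distrib)
  from power_mult_distrib_commuting[OF this, of 2]
  have "?p * (1 - ?q) * (?p * (1 - ?q)) = ?p * ?p * ((1 - ?q) * (1 - ?q))"
    by (simp only: power2_eq_square)
  also have "?p * ?p = ?p" by (rule p_drazin_projection(1)[OF x])
  also have "(1 - ?q) * (1 - ?q) = 1 - ?q"
    using p_drazin_projection(1)[OF y] by (simp add: right_diff_distrib left_diff_distrib)
  finally have idem: "?p * (1 - ?q) * (?p * (1 - ?q)) = ?p * (1 - ?q)" .
  obtain k where k: "k > 0" "a ^ k * (1 - ?q) \<in> jacobson_radical"
    using p_drazin_projection(7)[OF y] by blast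
  have "?p * (1 - ?q) = x ^ k * (a ^ k * (1 - ?q))"
    by (simp only: p_drazin_projection(6)[OF x k(1)] mult.assoc[symmetric])
  then have "?p * (1 - ?q) \<in> jacobson_radical" using jacobson_radical_mult_left[OF k(2)] by simp
  from jacobson_radical_idempotent[OF this idem] show ?thesis .
qed

lemma is_p_drazin_inverse_unique:
  fixes a x y :: "'a::complex_banach_algebra_1"
  assumes x: "is_p_drazin_inverse a x" and y: "is_p_drazin_inverse a y"
  shows "x = y"
proof -
  have cx: "a * x = x * a" and cy: "a * y = y * a"
    using x y unfolding is_p_drazin_inverse_def by auto
  \<comment> \<open>Since \<open>y\<close> commutes with \<open>a\<close>, the previous commutation
    result applies with scalar 1.\<close>
  have xy: "x * y = y * x"
    using p_drazin_inverse_commute_up_to_scalar[OF x, of 1 y] cy by simp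
  have "a * x * (1 - a * y) = 0" "a * y * (1 - a * x) = 0"
    using p_drazin_projection_mult_complement x y xy by metis+
  then have "a * x = a * x * (a * y)" "a * y = a * y * (a * x)" by (simp_all add: right_diff_distrib)
  moreover have "a * x * (a * y) = a * y * (a * x)" by (metis xy cx cy mult.assoc)
  ultimately have eq: "a * x = a * y" by simp
  have "x = x * (a * x)" using p_drazin_projection(3)[OF x] by simp
  also have "\<dots> = a * x * y" by (simp only: eq) (metis eq cx mult.assoc)
  also have "\<dots> = y" using eq p_drazin_projection(4)[OF y] by simp
  finally show ?thesis .
qed

lemma p_drazin_inverse_eqI:
  fixes a x :: "'a::complex_banach_algebra_1"
  assumes "is_p_drazin_inverse a x"
  shows "a\<^sup>\<ddagger> = x"
  unfolding p_drazin_inverse_def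
  by (rule the_equality) (use assms is_p_drazin_inverse_unique in blast)+

text \<open>The scalar is \<open>c\<close> to the power \<open>n * (n - 1) / 2\<close>. Its value is
  left open, as membership in the radical is insensitive to scalars.\<close>

lemma power_mult_up_to_scalar:
  fixes a b :: "'a::complex_banach_algebra_1"
  assumes "b * a = c *\<^sub>C (a * b)"
  shows "\<exists>d. (a * b) ^ n = d *\<^sub>C (a ^ n * b ^ n)"
proof (induction n)
  case 0
  show ?case by (rule exI[of _ 1]) simp
next
  case (Suc n)
  then obtain d where d: "(a * b) ^ n = d *\<^sub>C (a ^ n * b ^ n)" by blast
  have "b * a ^ n = c ^ n *\<^sub>C (a ^ n * b)"
  proof (induction n)
    case (Suc n)
    have "b * a ^ Suc n = c *\<^sub>C (a * (b * a ^ n))"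
      by (simp add: mult.assoc[symmetric] assms mult_scaleC_left)
    then show ?case by (simp add: Suc mult_scaleC_right scaleC_scaleC mult.assoc)
  qed simp
  moreover have "(a * b) ^ Suc n = d *\<^sub>C (a * (b * a ^ n) * b ^ n)"
    by (simp add: d mult_scaleC_right mult.assoc)
  ultimately have "(a * b) ^ Suc n = (d * c ^ n) *\<^sub>C (a ^ Suc n * b ^ Suc n)"
    by (simp add: mult_scaleC_left mult_scaleC_right scaleC_scaleC mult.assoc)
  then show ?case by blast
qed

text \<open>The idempotents \<open>p\<close> and \<open>q\<close> commute, and \<open>a * b\<close>
  times \<open>y * x\<close>, in either order, is \<open>p * q\<close>. The radical condition
  follows by splitting \<open>1 - p * q\<close> into \<open>(1 - p) + p * (1 - q)\<close>.\<close>

lemma is_p_drazin_inverse_mult: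
  fixes a b x y :: "'a::complex_banach_algebra_1"
  assumes x: "is_p_drazin_inverse a x" and y: "is_p_drazin_inverse b y"
    and "\<mu> \<noteq> 0" and ab: "a * b = \<mu> *\<^sub>C (b * a)"
  shows "is_p_drazin_inverse (a * b) (y * x)"
proof -
  define p where "p = a * x"
  define q where "q = b * y"
  note projp = p_drazin_projection[OF x, folded p_def] and projq = p_drazin_projection[OF y, folded q_def]
  have ba: "b * a = inverse \<mu> *\<^sub>C (a * b)" by (rule eq_scaleC_swap[OF ab \<open>\<mu> \<noteq> 0\<close>])
  have "inverse \<mu> \<noteq> 0" using \<open>\<mu> \<noteq> 0\<close> by simp
  have cx: "p = x * a" and cy: "q = y * b"
    using x y unfolding is_p_drazin_inverse_def p_def q_def by auto
  have bx: "b * x = \<mu> *\<^sub>C (x * b)" by (rule p_drazin_inverse_commute_up_to_scalar[OF x \<open>\<mu> \<noteq> 0\<close> ab])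
  have pb: "p * b = b * p"
    unfolding p_def by (rule p_drazin_projection_commutes[OF x \<open>\<mu> \<noteq> 0\<close> ab])
  have qa: "q * a = a * q"
    unfolding q_def by (rule p_drazin_projection_commutes[OF y \<open>inverse \<mu> \<noteq> 0\<close> ba])
  have qx: "q * x = x * q"
    unfolding q_def by (rule p_drazin_projection_commutes[OF y \<open>\<mu> \<noteq> 0\<close> bx])
  have pq: "p * q = q * p" unfolding p_def by (metis qa qx mult.assoc)
  have py: "p * y = y * p"
    using p_drazin_inverse_commute_up_to_scalar[OF y, of 1 p] pb by simp
  have l: "a * b * (y * x) = p * q"
  proof -
    have "a * b * (y * x) = a * q * x" by (simp add: q_def mult.assoc)
    also have "\<dots> = q * p" by (simp add: qa[symmetric] p_def mult.assoc)
    finally show ?thesis using pq by simp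
  qed
  have r: "y * x * (a * b) = p * q"
  proof -
    have "y * x * (a * b) = y * p * b" by (simp add: cx mult.assoc)
    also have "\<dots> = p * q" by (simp add: py[symmetric] cy mult.assoc)
    finally show ?thesis .
  qed
  have "y * x * (a * b) * (y * x) = q * (p * y) * x" by (simp only: r) (simp only: pq mult.assoc)
  also have "\<dots> = (q * y) * (p * x)" by (simp only: py mult.assoc)
  also have "\<dots> = y * x" by (simp only: projq(4) projp(4))
  finally have outer: "y * x * (a * b) * (y * x) = y * x" .
  obtain k m where k: "k > 0" "a ^ k * (1 - p) \<in> jacobson_radical"
    and m: "m > 0" "b ^ m * (1 - q) \<in> jacobson_radical"
    using projp(7) projq(7) by blast
  \<comment> \<open>A common exponent for both factors: extra powers multiplied on the left stay in
    the radical.\<close>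
  define n where "n = k + m"
  have an: "a ^ n * (1 - p) \<in> jacobson_radical"
    using jacobson_radical_mult_left[OF k(2), of "a ^ m"]
    by (simp add: n_def power_add[symmetric] mult.assoc[symmetric] add.commute)
  have bn: "b ^ n * (1 - q) \<in> jacobson_radical"
    using jacobson_radical_mult_left[OF m(2), of "b ^ k"]
    by (simp add: n_def power_add[symmetric] mult.assoc[symmetric])
  obtain d where d: "(a * b) ^ n = d *\<^sub>C (a ^ n * b ^ n)"
    using power_mult_up_to_scalar[OF ba] by blast
  have bnp: "b ^ n * p = p * b ^ n" by (rule power_commuting_commutes) (rule pb[symmetric])
  \<comment> \<open>In each summand one factor lies in the radical, once \<open>p\<close> has been
    moved past \<open>b ^ n\<close>; the radical absorbs multiplication from both sides.\<close>
  have "a ^ n * b ^ n * (1 - p * q)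
      = (a ^ n * (1 - p)) * b ^ n + a ^ n * p * (b ^ n * (1 - q))"
    by (simp add: right_diff_distrib left_diff_distrib mult.assoc bnp)
       (simp add: mult.assoc[symmetric] bnp)
  also have "\<dots> \<in> jacobson_radical"
    by (intro jacobson_radical_add jacobson_radical_mult_right jacobson_radical_mult_left an bn)
  finally have "(a * b) ^ n * (1 - p * q) \<in> jacobson_radical"
    by (simp add: d mult_scaleC_left jacobson_radical_scaleC)
  moreover have "(a * b) ^ n * (1 - p * q) = (a * b) ^ n - (a * b) ^ (n + 1) * (y * x)"
    by (simp add: l[symmetric] right_diff_distrib power_Suc2 mult.assoc del: power_Suc)
  moreover have "n \<ge> 1" using k(1) by (simp add: n_def)
  ultimately show ?thesis unfolding is_p_drazin_inverse_def using l r outer by auto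
qed

theorem theorem3p3:
  fixes a b :: "'a::complex_banach_algebra_1" and \<mu> :: complex
  assumes "\<mu> \<noteq> 0"
    and "p_drazin_invertible a"
    and "p_drazin_invertible b"
    and "a * b = \<mu> *\<^sub>C (b * a)"
  shows "a\<^sup>\<ddagger> * b = inverse \<mu> *\<^sub>C (b * a\<^sup>\<ddagger>)
    \<and> a * b\<^sup>\<ddagger> = inverse \<mu> *\<^sub>C (b\<^sup>\<ddagger> * a)
    \<and> p_drazin_invertible (a * b)
    \<and> (a * b)\<^sup>\<ddagger> = b\<^sup>\<ddagger> * a\<^sup>\<ddagger>
    \<and> b\<^sup>\<ddagger> * a\<^sup>\<ddagger> = inverse \<mu> *\<^sub>C (a\<^sup>\<ddagger> * b\<^sup>\<ddagger>)"
proof -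
  obtain x y where x: "is_p_drazin_inverse a x" and y: "is_p_drazin_inverse b y"
    using assms(2,3) unfolding p_drazin_invertible_def by blast
  have \<mu>': "inverse \<mu> \<noteq> 0" using assms(1) by simp
  have bx: "b * x = \<mu> *\<^sub>C (x * b)"
    by (rule p_drazin_inverse_commute_up_to_scalar[OF x assms(1,4)])
  have "b * a = inverse \<mu> *\<^sub>C (a * b)" by (rule eq_scaleC_swap[OF assms(4,1)])
  then have ay: "a * y = inverse \<mu> *\<^sub>C (y * a)"
    by (rule p_drazin_inverse_commute_up_to_scalar[OF y \<mu>'])
  \<comment> \<open>The relation \<open>bx\<close> between \<open>b\<close> and \<open>x\<close> has
    the shape of the hypothesis, so it passes from \<open>b\<close> to its inverse
    \<open>y\<close>.\<close>
  have "x * y = \<mu> *\<^sub>C (y * x)"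
    by (rule p_drazin_inverse_commute_up_to_scalar[OF y assms(1) bx])
  then have yx: "y * x = inverse \<mu> *\<^sub>C (x * y)" using assms(1) by (rule eq_scaleC_swap)
  have xb: "x * b = inverse \<mu> *\<^sub>C (b * x)" using bx assms(1) by (rule eq_scaleC_swap)
  note xy = is_p_drazin_inverse_mult[OF x y assms(1,4)]
  show ?thesis
    using xb ay yx xy p_drazin_inverse_eqI[OF x] p_drazin_inverse_eqI[OF y] p_drazin_inverse_eqI[OF xy]
    unfolding p_drazin_invertible_def by auto
qed

end
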